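(* Let $\mu\ge 0$ and let $f:\mathbb{R}^d\to\mathbb{R}$ be a differentiable function. Then $f$ is $\mu$-strongly-convex if and only if any one of the following conditions holds (that is, each of the three conditions is individually equivalent to $\mu$-strong-convexity of $f$): (a) $f(\lambda x+(1-\lambda)y)\le \lambda f(x)+(1-\lambda)f(y)-\frac\mu2\lambda(1-\lambda)\|x-y\|^2$ for all $x,y\in\mathbb{R}^d$, $\lambda\in[0,1]$; (b) $\langle\nabla f(x)-\nabla f(y),x-y\rangle\ge\mu\|x-y\|^2$ for all $x,y\in\mathbb{R}^d$; (c) $f(y)\ge f(x)+\langle\nabla f(x),y-x\rangle+\frac\mu2\|x-y\|^2$ for all $x,y\in\mathbb{R}^d$.
   Context: $\mathbb{R}^d$ carries the dot product $\langle\cdot,\cdot\rangle$ and the induced Euclidean norm $\|\cdot\|$. For a differentiable function $h$, the Bregman distance is $D_h(x,y):=h(x)-h(y)-\langle\nabla h(y),x-y\rangle$. Let $\varphi_0=\frac12\|\cdot\|^2$. A differentiable function $f:\mathbb{R}^d\to\mathbb{R}$ is called $\mu$-strongly-convex if $\mu\,D_{\varphi_0}(x,y)\le D_f(x,y)$ for all $x,y\in\mathbb{R}^d$. *)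

theory Defs
  imports "HOL-Analysis.Analysis"
begin

(* GDERIV f x :> D is the library's relation "D is the gradient of f at x";
   gradient turns it into a function, meaningful only where f is differentiable. *)
definition gradient :: "('a::real_inner \<Rightarrow> real) \<Rightarrow> 'a \<Rightarrow> 'a" where
  "gradient f x = (THE D. GDERIV f x :> D)"

lemma gradient_eqI:
  assumes "GDERIV f x :> D"
  shows "gradient f x = D"
  unfolding gradient_def
proof (rule the_equality)
  show "GDERIV f x :> D" by (fact assms)
next
  fix E assume "GDERIV f x :> E"
  then have "(\<lambda>h. inner h E) = (\<lambda>h. inner h D)"
    using assms unfolding gderiv_def by (rule has_derivative_unique)
  then have "inner (E - D) E = inner (E - D) D" by meson
  then have "inner (E - D) (E - D) = 0" by (simp add: inner_diff_right)
  then show "E = D" by simp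
qed

lemma GDERIV_gradient:
  fixes f :: "'a::euclidean_space \<Rightarrow> real"
  assumes "f differentiable at x"
  shows "GDERIV f x :> gradient f x"
proof -
  obtain f' where f': "(f has_derivative f') (at x)"
    using assms unfolding differentiable_def by blast
  then have "linear f'" by (rule has_derivative_linear)
  then have "f' = (\<lambda>h. inner h (adjoint f' 1))"
    using adjoint_works[of f' _ 1] by (auto simp: fun_eq_iff)
  with f' have "GDERIV f x :> adjoint f' 1"
    unfolding gderiv_def by simp
  then show ?thesis using gradient_eqI by metis
qed

definition bregman :: "('a::real_inner \<Rightarrow> real) \<Rightarrow> 'a \<Rightarrow> 'a \<Rightarrow> real" where
  "bregman h x y = h x - h y - inner (gradient h y) (x - y)"

definition phi0 :: "'a::real_inner \<Rightarrow> real" where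
  "phi0 x = 1 / 2 * (norm x)\<^sup>2"

definition strongly_convex :: "real \<Rightarrow> ('a::real_inner \<Rightarrow> real) \<Rightarrow> bool" where
  "strongly_convex \<mu> f \<longleftrightarrow>
     (\<forall>x. f differentiable at x) \<and>
     (\<forall>x y. \<mu> * bregman phi0 x y \<le> bregman f x y)"

end

theory Submission
  imports Defs
begin

text \<open>
  The Bregman distance of \<open>phi0\<close> is half the squared distance, so strong convexity is
  literally the quadratic lower bound (c), and it remains to relate (c) to (a) and to (b).
  Both (a) and (b) are statements about the restrictions of \<open>f\<close> to lines, where \<open>f\<close> is a
  differentiable function of one real variable.

  From (c) one obtains (a) by averaging the two lower bounds of \<open>f x\<close> and \<open>f y\<close> based at
  the intermediate point: the gradient terms cancel. Conversely, dividing (a) by \<open>t\<close> bounds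
  a difference quotient at the base point, and \<open>t \<rightarrow> 0\<close> yields (c).
  From (c) one obtains (b) by adding the bound to the one with the points exchanged.
  Conversely, (b) compares the gradient at a point of the segment with that at its base point,
  which says that the gap in (c) has nonnegative derivative along the segment; the gap vanishes at
  the base point, hence it is nonnegative.
\<close>

lemma gradient_phi0:
  fixes y :: "'a::euclidean_space"
  shows "gradient phi0 y = y"
proof (rule gradient_eqI)
  have "(\<lambda>x::'a. phi0 x) = (\<lambda>x. 1 / 2 * inner x x)"
    by (simp add: phi0_def power2_norm_eq_inner)
  moreover have "((\<lambda>x. 1 / 2 * inner x x) has_derivative (\<lambda>h. inner h y)) (at y)"
    by (auto intro!: derivative_eq_intros simp: inner_commute)
  ultimately show "GDERIV phi0 y :> y"
    by (simp add: gderiv_def)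
qed

lemma bregman_phi0:
  fixes x y :: "'a::euclidean_space"
  shows "bregman phi0 x y = 1 / 2 * (norm (x - y))\<^sup>2"
  by (simp add: bregman_def gradient_phi0 phi0_def power2_norm_eq_inner
      inner_diff_left inner_diff_right inner_commute field_simps)

lemma strongly_convex_iff_quadratic_lower_bound:
  fixes f :: "'a::euclidean_space \<Rightarrow> real"
  assumes "\<And>x. f differentiable at x"
  shows "strongly_convex \<mu> f \<longleftrightarrow>
    (\<forall>x y. f y \<ge> f x + inner (gradient f x) (y - x) + \<mu> / 2 * (norm (x - y))\<^sup>2)"
proof -
  have "\<mu> * bregman phi0 y x \<le> bregman f y x \<longleftrightarrow>
      f y \<ge> f x + inner (gradient f x) (y - x) + \<mu> / 2 * (norm (x - y))\<^sup>2" for x y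
    unfolding bregman_phi0 by (auto simp: bregman_def norm_minus_commute)
  then show ?thesis
    using assms unfolding strongly_convex_def by blast
qed

lemma has_real_derivative_along_line:
  fixes f :: "'a::euclidean_space \<Rightarrow> real"
  assumes "f differentiable at (x + t *\<^sub>R v)"
  shows "((\<lambda>s. f (x + s *\<^sub>R v)) has_real_derivative inner (gradient f (x + t *\<^sub>R v)) v) (at t)"
proof -
  have "(f has_derivative (\<lambda>h. inner h (gradient f (x + t *\<^sub>R v)))) (at (x + t *\<^sub>R v))"
    using GDERIV_gradient[OF assms] by (simp add: gderiv_def)
  moreover have "((\<lambda>s. x + s *\<^sub>R v) has_derivative (\<lambda>h. h *\<^sub>R v)) (at t)"
    by (auto intro!: derivative_eq_intros)
  ultimately have "((\<lambda>s. f (x + s *\<^sub>R v)) has_derivative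
      (\<lambda>h. inner (h *\<^sub>R v) (gradient f (x + t *\<^sub>R v)))) (at t)"
    by (rule has_derivative_compose[rotated])
  then show ?thesis
    by (rule has_derivative_imp_has_field_derivative) (simp add: inner_commute mult.commute)
qed

text \<open>
  Weighting the two bounds by \<open>t\<close> and \<open>1 - t\<close> cancels the gradient terms, while the
  quadratic terms add up by \<open>t * (1 - t)\<^sup>2 + (1 - t) * t\<^sup>2 = t * (1 - t)\<close>.
\<close>

lemma quadratic_lower_bound_imp_convexity_inequality:
  fixes f :: "'a::euclidean_space \<Rightarrow> real"
  assumes lower: "\<And>x y. f y \<ge> f x + inner (gradient f x) (y - x) + \<mu> / 2 * (norm (x - y))\<^sup>2"
    and t: "t \<in> {0..1}"
  shows "f (t *\<^sub>R x + (1 - t) *\<^sub>R y)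
    \<le> t * f x + (1 - t) * f y - \<mu> / 2 * t * (1 - t) * (norm (x - y))\<^sup>2"
proof -
  define z where "z = t *\<^sub>R x + (1 - t) *\<^sub>R y"
  define d where "d = inner (gradient f z) (x - y)"
  have xz: "x - z = (1 - t) *\<^sub>R (x - y)" and yz: "y - z = (- t) *\<^sub>R (x - y)"
    by (simp_all add: z_def algebra_simps)
  have norms: "(norm (z - x))\<^sup>2 = (1 - t)\<^sup>2 * (norm (x - y))\<^sup>2" "(norm (z - y))\<^sup>2 = t\<^sup>2 * (norm (x - y))\<^sup>2"
    unfolding norm_minus_commute[of z] xz yz by (simp_all add: power_mult_distrib)
  have "f x \<ge> f z + (1 - t) * d + \<mu> / 2 * ((1 - t)\<^sup>2 * (norm (x - y))\<^sup>2)"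
    using lower[of z x] unfolding norms by (simp add: xz d_def)
  then have "t * (f z + (1 - t) * d + \<mu> / 2 * ((1 - t)\<^sup>2 * (norm (x - y))\<^sup>2)) \<le> t * f x"
    using t by (intro mult_left_mono) auto
  moreover have "f y \<ge> f z - t * d + \<mu> / 2 * (t\<^sup>2 * (norm (x - y))\<^sup>2)"
    using lower[of z y] unfolding norms by (simp add: yz d_def)
  then have "(1 - t) * (f z - t * d + \<mu> / 2 * (t\<^sup>2 * (norm (x - y))\<^sup>2)) \<le> (1 - t) * f y"
    using t by (intro mult_left_mono) auto
  moreover have "t * (f z + (1 - t) * d + \<mu> / 2 * ((1 - t)\<^sup>2 * (norm (x - y))\<^sup>2))
      + (1 - t) * (f z - t * d + \<mu> / 2 * (t\<^sup>2 * (norm (x - y))\<^sup>2))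
    = f z + \<mu> / 2 * t * (1 - t) * (norm (x - y))\<^sup>2"
    by (simp add: field_simps power2_eq_square)
  ultimately show ?thesis
    unfolding z_def by linarith
qed

text \<open>
  Convexity bounds the slope of every chord issuing from \<open>x\<close> towards \<open>y\<close>; the slopes tend to the
  directional derivative at \<open>x\<close>, and the bounds pass to the limit.
\<close>

lemma convexity_inequality_imp_quadratic_lower_bound:
  fixes f :: "'a::euclidean_space \<Rightarrow> real"
  assumes diff: "f differentiable at x"
    and convex: "\<And>t. t \<in> {0..1} \<Longrightarrow> f (t *\<^sub>R y + (1 - t) *\<^sub>R x)
      \<le> t * f y + (1 - t) * f x - \<mu> / 2 * t * (1 - t) * (norm (y - x))\<^sup>2"
  shows "f y \<ge> f x + inner (gradient f x) (y - x) + \<mu> / 2 * (norm (x - y))\<^sup>2"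
proof -
  define v where "v = y - x"
  define bound where "bound t = f y - f x - \<mu> / 2 * (1 - t) * (norm v)\<^sup>2" for t
  have "((\<lambda>s. f (x + s *\<^sub>R v)) has_real_derivative inner (gradient f x) v) (at 0)"
    using has_real_derivative_along_line[of f x 0 v] diff by simp
  then have "((\<lambda>t. (f (x + t *\<^sub>R v) - f x) / t) \<longlongrightarrow> inner (gradient f x) v) (at 0)"
    by (simp add: DERIV_def)
  then have quotient: "((\<lambda>t. (f (x + t *\<^sub>R v) - f x) / t) \<longlongrightarrow> inner (gradient f x) v) (at_right 0)"
    by (rule tendsto_mono[OF at_le, rotated]) simp
  have "(bound \<longlongrightarrow> bound 0) (at_right 0)"
    unfolding bound_def by (intro tendsto_intros)
  moreover have "(f (x + t *\<^sub>R v) - f x) / t \<le> bound t" if "0 < t" "t < 1" for t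
  proof -
    have "t *\<^sub>R y + (1 - t) *\<^sub>R x = x + t *\<^sub>R v"
      by (simp add: v_def algebra_simps)
    then have "f (x + t *\<^sub>R v) - f x \<le> bound t * t"
      using convex[of t] that by (simp add: bound_def v_def algebra_simps)
    then show ?thesis
      using that by (simp add: divide_le_eq)
  qed
  then have "\<forall>\<^sub>F t in at_right 0. (f (x + t *\<^sub>R v) - f x) / t \<le> bound t"
    unfolding eventually_at_right_field by (intro exI[of _ 1]) auto
  ultimately have "inner (gradient f x) v \<le> bound 0"
    using quotient by (intro tendsto_le[of "at_right (0::real)"]) auto
  then show ?thesis
    by (simp add: bound_def v_def norm_minus_commute)
qed

lemma quadratic_lower_bound_imp_gradient_strongly_monotone:
  fixes f :: "'a::euclidean_space \<Rightarrow> real"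
  assumes "\<And>x y. f y \<ge> f x + inner (gradient f x) (y - x) + \<mu> / 2 * (norm (x - y))\<^sup>2"
  shows "inner (gradient f x - gradient f y) (x - y) \<ge> \<mu> * (norm (x - y))\<^sup>2"
proof -
  have "inner (gradient f x) (y - x) = - inner (gradient f x) (x - y)"
    by (simp add: inner_diff_right)
  then show ?thesis
    using assms[of x y] assms[of y x] by (simp add: norm_minus_commute inner_diff_left)
qed

text \<open>
  The excess of \<open>f\<close> over its quadratic lower bound at \<open>x + t *\<^sub>R (y - x)\<close> vanishes at \<open>t = 0\<close>,
  and strong monotonicity of the gradient says that it does not decrease in \<open>t \<ge> 0\<close>.
\<close>

lemma gradient_strongly_monotone_imp_quadratic_lower_bound:
  fixes f :: "'a::euclidean_space \<Rightarrow> real"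
  assumes diff: "\<And>x. f differentiable at x"
    and mono: "\<And>x y. inner (gradient f x - gradient f y) (x - y) \<ge> \<mu> * (norm (x - y))\<^sup>2"
  shows "f y \<ge> f x + inner (gradient f x) (y - x) + \<mu> / 2 * (norm (x - y))\<^sup>2"
proof -
  define v where "v = y - x"
  define gap where
    "gap t = f (x + t *\<^sub>R v) - t * inner (gradient f x) v - \<mu> / 2 * t\<^sup>2 * (norm v)\<^sup>2" for t
  define gap' where
    "gap' t = inner (gradient f (x + t *\<^sub>R v)) v - inner (gradient f x) v - \<mu> * t * (norm v)\<^sup>2" for t
  have deriv: "(gap has_real_derivative gap' t) (at t)" for t
  proof -
    have "((\<lambda>t. t * inner (gradient f x) v) has_real_derivative inner (gradient f x) v) (at t)"
      "((\<lambda>t. \<mu> / 2 * t\<^sup>2 * (norm v)\<^sup>2) has_real_derivative \<mu> * t * (norm v)\<^sup>2) (at t)"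
      by (auto intro!: derivative_eq_intros)
    then show ?thesis
      unfolding gap_def gap'_def
      by (intro DERIV_diff has_real_derivative_along_line diff)
  qed
  have nonneg: "gap' t \<ge> 0" if "t \<ge> 0" for t
  proof (cases "t = 0")
    case False
    with that have "t > 0" by simp
    \<comment> \<open>The displacement from \<open>x\<close> to \<open>x + t *\<^sub>R v\<close> is \<open>t *\<^sub>R v\<close>, so monotonicity gives \<open>t\<close> times the claim.\<close>
    moreover have "t * gap' t \<ge> 0"
      using mono[of "x + t *\<^sub>R v" x]
      by (simp add: gap'_def inner_diff_left power_mult_distrib algebra_simps power2_eq_square)
    ultimately show ?thesis
      by (simp add: zero_le_mult_iff)
  qed (simp add: gap'_def)
  have "gap 0 \<le> gap 1"
    using deriv nonneg by (intro DERIV_nonneg_imp_nondecreasing[of 0 1 gap]) auto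
  then show ?thesis
    by (simp add: gap_def v_def norm_minus_commute)
qed

theorem proposition3p3:
  fixes \<mu> :: real and f :: "real ^ 'd \<Rightarrow> real"
  assumes "\<mu> \<ge> 0"
    and "\<And>x. f differentiable at x"
  shows "(strongly_convex \<mu> f \<longleftrightarrow>
      (\<forall>x y. \<forall>t\<in>{0..1}. f (t *\<^sub>R x + (1 - t) *\<^sub>R y)
         \<le> t * f x + (1 - t) * f y - \<mu> / 2 * t * (1 - t) * (norm (x - y))\<^sup>2))
    \<and> (strongly_convex \<mu> f \<longleftrightarrow>
      (\<forall>x y. inner (gradient f x - gradient f y) (x - y) \<ge> \<mu> * (norm (x - y))\<^sup>2))
    \<and> (strongly_convex \<mu> f \<longleftrightarrow>
      (\<forall>x y. f y \<ge> f x + inner (gradient f x) (y - x) + \<mu> / 2 * (norm (x - y))\<^sup>2))"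
proof -
  note diff = assms(2)
  note sc = strongly_convex_iff_quadratic_lower_bound[of f \<mu>, OF diff]
  have "strongly_convex \<mu> f \<longleftrightarrow>
      (\<forall>x y. \<forall>t\<in>{0..1}. f (t *\<^sub>R x + (1 - t) *\<^sub>R y)
         \<le> t * f x + (1 - t) * f y - \<mu> / 2 * t * (1 - t) * (norm (x - y))\<^sup>2)"
    unfolding sc
    using quadratic_lower_bound_imp_convexity_inequality[of f \<mu>]
      convexity_inequality_imp_quadratic_lower_bound[of f _ _ \<mu>, OF diff]
    by blast
  moreover have "strongly_convex \<mu> f \<longleftrightarrow>
      (\<forall>x y. inner (gradient f x - gradient f y) (x - y) \<ge> \<mu> * (norm (x - y))\<^sup>2)"
    unfolding sc
    using quadratic_lower_bound_imp_gradient_strongly_monotone[of f \<mu>]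
      gradient_strongly_monotone_imp_quadratic_lower_bound[of f \<mu>, OF diff]
    by blast
  ultimately show ?thesis
    using sc by blast
qed

end
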